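(* Let $n$ be even. If $\mathcal{F}\subseteq 2^{[n]}$ is such that every component of $G_\mathcal{F}$ has at most $4$ vertices, then \[ |\mathcal{F}|\le 4\binom{n-2}{n/2-1}. \]
   Context: For $\mathcal{F}\subseteq 2^{[n]}$, $G_\mathcal{F}$ is the graph on $\mathcal{F}$ with distinct $A,B$ adjacent iff $A\subseteq B$ or $B\subseteq A$. *)

theory Defs imports Main begin

text \<open>
  A simple graph is given by a vertex set and a symmetric irreflexive set of ordered pairs,
  each edge occurring in both orientations.
\<close>

definition comparability_edges :: "'a set set \<Rightarrow> ('a set \<times> 'a set) set" where
  "comparability_edges F =
     {(A, B). A \<in> F \<and> B \<in> F \<and> A \<noteq> B \<and> (A \<subseteq> B \<or> B \<subseteq> A)}"

text \<open>
  The vertex sets of the connected components of the graph with vertices \<open>V\<close> and (symmetric)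
  edges \<open>E \<subseteq> V \<times> V\<close>: the classes of the relation ``joined by a walk''. Walks of length zero
  are allowed, so an isolated vertex forms a component on its own.
\<close>

definition components :: "'v set \<Rightarrow> ('v \<times> 'v) set \<Rightarrow> 'v set set" where
  "components V E = V // E\<^sup>*"

end

theory Submission
  imports Defs Complex_Main "HOL-Combinatorics.Multiset_Permutations"
begin

text \<open>
  The argument is of LYM type. Write \<open>n = 2 m\<close>. If \<open>\<emptyset>\<close> or \<open>[n]\<close> is in \<open>F\<close>, then \<open>F\<close> is a single component.
  Otherwise charge each of the \<open>n!\<close> maximal chains that meets \<open>F\<close> to the member of \<open>F\<close> on it closest to the
  middle level. By the union bound, a set at level \<open>m \<plusminus> 1\<close> that can be blocked by \<open>d\<close> sets
  is charged at least \<open>(1 + (1 - d) / m) m!\<^sup>2\<close> times, while a set in the middle level is charged exactly \<open>m!\<^sup>2\<close> times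
  and a set further away at least \<open>(1 + 1 / m) m!\<^sup>2\<close> times. In a component with at most four vertices
  the losses add up to at most half the number of vertices (in units of \<open>m!\<^sup>2 / m\<close>), so
  \<open>(1 - 1 / n) m!\<^sup>2 |F| \<le> n!\<close>, which is the claim.
\<close>

section \<open>Maximal chains through given sets\<close>

text \<open>A permutation \<open>xs\<close> of \<open>S\<close> encodes the maximal chain of the sets \<open>set (take k xs)\<close>.\<close>

definition hits :: "'a set \<Rightarrow> 'a set \<Rightarrow> 'a list set" where
  "hits S A = {xs \<in> permutations_of_set S. set (take (card A) xs) = A}"

lemma finite_hits [simp]: "finite (hits S A)"
  by (simp add: hits_def)

lemma length_of_permutation:
  "xs \<in> permutations_of_set S \<Longrightarrow> length xs = card S"
  by (metis permutations_of_setD distinct_card)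

text \<open>The common length \<open>k\<close> of the left factors fixes where to cut a
  concatenation, which makes it injective.\<close>

lemma card_append_image:
  assumes "\<And>u. u \<in> U \<Longrightarrow> length u = k"
  shows "card ((\<lambda>(u, v). u @ v) ` (U \<times> V)) = card U * card V"
proof -
  have "inj_on (\<lambda>(u, v). u @ v) (U \<times> V)"
    using assms by (auto simp: inj_on_def)
  then show ?thesis
    by (simp add: card_image card_cartesian_product)
qed

text \<open>A chain through \<open>A\<close> and \<open>B\<close> splits at \<open>B\<close> into a
  chain of \<open>B\<close> through \<open>A\<close> and an arbitrary chain of the complement. The
  case \<open>A = B\<close> yields the count for a single set.\<close>

lemma hits_Int_eq_append:
  assumes "finite S" "A \<subseteq> B" "B \<subseteq> S"
  shows "hits S A \<inter> hits S B = (\<lambda>(u, v). u @ v) ` (hits B A \<times> permutations_of_set (S - B))"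
proof (intro equalityI subsetI)
  have fin: "finite B" using assms finite_subset by blast
  then have cAB: "card A \<le> card B" using assms card_mono by blast
  fix xs
  {
    assume xs: "xs \<in> hits S A \<inter> hits S B"
    define u v where "u = take (card B) xs" and "v = drop (card B) xs"
    have d: "distinct xs" "set xs = S" and tB: "set u = B" and tA: "set (take (card A) xs) = A"
      using xs by (auto simp: hits_def u_def dest: permutations_of_setD)
    have split: "xs = u @ v" by (simp add: u_def v_def)
    have "set v = S - B" "distinct u" "distinct v"
      using d tB unfolding split by auto
    moreover have "take (card A) u = take (card A) xs"
      using cAB by (simp add: u_def min_def)
    ultimately have "u \<in> hits B A" "v \<in> permutations_of_set (S - B)"
      using tA tB by (auto simp: hits_def permutations_of_set_def)
    then show "xs \<in> (\<lambda>(u, v). u @ v) ` (hits B A \<times> permutations_of_set (S - B))"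
      using split by auto
  next
    assume "xs \<in> (\<lambda>(u, v). u @ v) ` (hits B A \<times> permutations_of_set (S - B))"
    then obtain u v where xs: "xs = u @ v" and u: "u \<in> hits B A"
      and v: "v \<in> permutations_of_set (S - B)" by auto
    have len: "length u = card B"
      using u by (auto simp: hits_def length_of_permutation)
    have "xs \<in> permutations_of_set S"
      using u v assms unfolding xs hits_def permutations_of_set_def by auto
    then show "xs \<in> hits S A \<inter> hits S B"
      using u len cAB unfolding xs hits_def
      by (auto dest: permutations_of_setD)
  }
qed

lemma hits_self: "finite B \<Longrightarrow> hits B B = permutations_of_set B"
  by (auto simp: hits_def length_of_permutation dest: permutations_of_setD)

lemma card_hits:
  assumes "finite S" "A \<subseteq> S"
  shows "card (hits S A) = fact (card A) * fact (card S - card A)"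
proof -
  have finA: "finite A" using assms finite_subset by blast
  have "hits S A = (\<lambda>(u, v). u @ v) ` (permutations_of_set A \<times> permutations_of_set (S - A))"
    using hits_Int_eq_append[of S A A] assms hits_self[OF finA] by simp
  then show ?thesis
    using assms finA
    by (simp add: card_append_image[of _ "card A"] length_of_permutation card_Diff_subset)
qed

lemma card_hits_Int:
  assumes "finite S" "A \<subseteq> B" "B \<subseteq> S"
  shows "card (hits S A \<inter> hits S B) =
    fact (card A) * fact (card B - card A) * fact (card S - card B)"
proof -
  have "finite B" using assms finite_subset by blast
  moreover have "length u = card B" if "u \<in> hits B A" for u
    using that by (auto simp: hits_def length_of_permutation)
  ultimately show ?thesis
    using assms card_hits[of B A]
    by (simp add: hits_Int_eq_append card_append_image[of _ "card B"] card_Diff_subset)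
qed

text \<open>The quotient of the two factorial expressions is \<open>b choose a\<close>, which is at
  least \<open>b\<close> away from both ends of the row. This bounds the share of chains through one
  set that also meet another.\<close>

lemma mult_fact_fact_le:
  assumes "0 < a" "a < b"
  shows "b * (fact a * fact (b - a)) \<le> (fact b :: nat)"
proof -
  have "fact a * fact (b - a) * (b choose a) = (fact b :: nat)"
    using assms binomial_fact_lemma by simp
  moreover have "b \<le> b choose a" using assms by (simp add: upper_le_binomial)
  ultimately show ?thesis
    by (metis mult.commute mult_le_mono2)
qed

lemma card_hits_Int_le_upper:
  assumes "finite S" "A \<subset> B" "B \<subseteq> S" "A \<noteq> {}"
  shows "card B * card (hits S A \<inter> hits S B) \<le> card (hits S B)"
proof -
  have "finite B" using assms finite_subset by blast
  then have "0 < card A" "card A < card B"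
    using assms by (auto simp: psubset_card_mono card_gt_0_iff intro: finite_subset)
  from mult_fact_fact_le[OF this] show ?thesis
    using assms by (simp add: card_hits_Int card_hits mult.assoc[symmetric] psubset_imp_subset)
qed

text \<open>Mirror image of the previous bound: the part of the chain above \<open>A\<close> is a
  chain of \<open>S - A\<close>, and it passes through \<open>B - A\<close>, which is neither empty
  nor everything.\<close>

lemma card_hits_Int_le_lower:
  assumes "finite S" "A \<subset> B" "B \<subset> S"
  shows "(card S - card A) * card (hits S A \<inter> hits S B) \<le> card (hits S A)"
proof -
  have "finite B" using assms finite_subset by blast
  then have "card A < card B" "card B < card S"
    using assms by (auto simp: psubset_card_mono)
  then have "0 < card B - card A" "card B - card A < card S - card A"
    and eq: "card S - (card A + (card B - card A)) = card S - card B" by auto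
  from mult_fact_fact_le[OF this(1,2)] show ?thesis
    using assms by (simp add: card_hits_Int card_hits eq psubset_imp_subset mult_ac)
qed

text \<open>Passing from \<open>s\<close> to \<open>Suc s\<close> multiplies the product by
  \<open>(s + 1) / (2 * m - s)\<close>, which is at least 1 from the middle level on.\<close>

lemma fact_mult_fact_mono:
  fixes m r s :: nat
  assumes "r \<le> s" "m \<le> r" "s \<le> 2 * m"
  shows "fact r * fact (2 * m - r) \<le> (fact s * fact (2 * m - s) :: nat)"
  using assms
proof (induction s rule: dec_induct)
  case (step s)
  obtain j where j: "2 * m - s = Suc j" using step by (cases "2 * m - s") auto
  then have "2 * m - Suc s = j" "Suc j \<le> Suc s" using step by auto
  then have "fact s * fact (2 * m - s) \<le> (fact (Suc s) * fact (2 * m - Suc s) :: nat)"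
    using j by (simp add: algebra_simps del: mult_Suc)
  then show ?case using step by linarith
qed simp

section \<open>Weights\<close>

text \<open>Orders the levels of the Boolean lattice by their distance from the middle level \<open>m\<close>:
  the values on the levels \<open>m\<close>, \<open>m - 1\<close>, \<open>m + 1\<close> are \<open>0\<close>, \<open>1\<close>, \<open>2\<close>.\<close>

definition rk :: "nat \<Rightarrow> 'a set \<Rightarrow> nat" where
  "rk m A = (if m \<le> card A then 2 * (card A - m) else 2 * (m - card A) - 1)"

lemma rk_0: "rk m A = 0 \<longleftrightarrow> card A = m"
  by (auto simp: rk_def)

lemma rk_1: "rk m A = 1 \<longleftrightarrow> Suc (card A) = m"
  unfolding rk_def by (auto; presburger)

lemma rk_2: "rk m A = 2 \<longleftrightarrow> card A = Suc m"
  unfolding rk_def by (auto; presburger)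

lemma rk_ge_3: "3 \<le> rk m A \<longleftrightarrow> m + 2 \<le> card A \<or> card A + 2 \<le> m"
  unfolding rk_def by (auto; presburger)

lemma rk_inj: "rk m A = rk m B \<Longrightarrow> card A = card B"
  unfolding rk_def by (auto split: if_splits; presburger)

text \<open>With comparability this fixes the direction of inclusion: what blocks a set above the
  middle lies below it. The next lemma is the dual.\<close>

lemma rk_less_upper: "rk m X < rk m Y \<Longrightarrow> m < card Y \<Longrightarrow> card X < card Y"
  unfolding rk_def by (auto split: if_splits; presburger)

lemma rk_less_lower: "rk m X < rk m Y \<Longrightarrow> card Y < m \<Longrightarrow> card Y < card X"
  unfolding rk_def by (auto split: if_splits; presburger)

text \<open>A set strictly in between adds exactly one of the two elements of
  \<open>B - A\<close>.\<close>

lemma card_between_le_2: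
  assumes "finite B" "A \<subseteq> B" "card B = card A + 2"
  shows "card {X. A \<subset> X \<and> X \<subset> B} \<le> 2"
proof -
  have finA: "finite A" using assms finite_subset by blast
  have "{X. A \<subset> X \<and> X \<subset> B} \<subseteq> (\<lambda>x. insert x A) ` (B - A)"
  proof
    fix X assume "X \<in> {X. A \<subset> X \<and> X \<subset> B}"
    then have X: "A \<subset> X" "X \<subset> B" by auto
    then obtain x where x: "x \<in> X" "x \<notin> A" by blast
    have finX: "finite X" using X assms finite_subset by blast
    have "card X < card A + 2" using psubset_card_mono[OF assms(1) X(2)] assms(3) by simp
    moreover have "card A < card X" using psubset_card_mono[OF finX X(1)] .
    ultimately have "card (insert x A) = card X" using x finA by simp
    then have "insert x A = X" using X x finX by (intro card_subset_eq) auto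
    then show "X \<in> (\<lambda>x. insert x A) ` (B - A)" using x X by auto
  qed
  then have "card {X. A \<subset> X \<and> X \<subset> B} \<le> card (B - A)"
    using assms by (intro surj_card_le) auto
  also have "\<dots> = 2" using assms finA by (simp add: card_Diff_subset)
  finally show ?thesis .
qed

text \<open>The empty set and \<open>S\<close> lie on every maximal chain, so they would block all
  chains through another set; excluding them makes each blocking set cost only a small
  share.\<close>

locale middle_family =
  fixes S :: "'a set" and m :: nat and F :: "'a set set"
  assumes finS: "finite S" and cardS: "card S = 2 * m"
    and subF: "F \<subseteq> Pow S" and empty: "{} \<notin> F" and full: "S \<notin> F"
begin

text \<open>Every maximal chain is charged to the member of \<open>F\<close> on it of least \<open>rk\<close>; \<open>D Y\<close> collects the
  sets that can prevent a chain through \<open>Y\<close> from being charged to \<open>Y\<close>. A pair at levels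
  \<open>m - 1\<close> and \<open>m + 1\<close> all of whose intermediate sets are in \<open>F\<close> can be left out, because a chain
  through the pair also meets \<open>F\<close> in the middle level. The diamond, which is extremal, needs this.\<close>

definition D :: "'a set \<Rightarrow> 'a set set" where
  "D Y = {X \<in> F. (X \<subseteq> Y \<or> Y \<subseteq> X) \<and> rk m X < rk m Y \<and>
     \<not> (rk m X = 1 \<and> rk m Y = 2 \<and> (\<forall>M. X \<subset> M \<and> M \<subset> Y \<longrightarrow> M \<in> F))}"

text \<open>A union-bound estimate from below for the number of chains charged to \<open>Y\<close>.
  It is real-valued because it may be negative.\<close>

definition cost :: "'a set \<Rightarrow> real" where
  "cost Y = real (card (hits S Y)) - (\<Sum>X\<in>D Y. real (card (hits S X \<inter> hits S Y)))"

section \<open>Lower bounds for the charge of a single set\<close>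

lemma finF: "finite F"
  using subF finS by (meson finite_Pow_iff finite_subset)

lemma D_subset: "D Y \<subseteq> F"
  by (auto simp: D_def)

lemma finD: "finite (D Y)"
  using D_subset finF finite_subset by blast

lemma not_mem_D: "Y \<notin> D Y"
  by (simp add: D_def)

lemma finite_mem: "A \<in> F \<Longrightarrow> finite A"
  using subF finS finite_subset by blast

lemma card_bounds:
  assumes "A \<in> F"
  shows "0 < card A" "card A < 2 * m"
proof -
  show "0 < card A" using assms empty finite_mem card_gt_0_iff by blast
  have "A \<subset> S" using assms subF full by blast
  then show "card A < 2 * m" using psubset_card_mono[OF finS] cardS by metis
qed

text \<open>A blocking set lies below \<open>Y\<close> if \<open>Y\<close> is above the middle, and
  above \<open>Y\<close> otherwise. The maximum is the size of \<open>Y\<close> in the first case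
  and of its complement in the second, so one formula serves both.\<close>

lemma blocking_le:
  assumes "Y \<in> F" "X \<in> D Y"
  shows "max (card Y) (2 * m - card Y) * card (hits S X \<inter> hits S Y) \<le> card (hits S Y)"
proof -
  have X: "X \<in> F" "X \<subseteq> Y \<or> Y \<subseteq> X" "rk m X < rk m Y" using assms by (auto simp: D_def)
  have sub: "X \<subseteq> S" "Y \<subseteq> S" "X \<noteq> {}" "X \<noteq> S" using X assms subF empty full by auto
  have "card Y \<noteq> m" using X(3) rk_0[of m Y] by auto
  then consider "m < card Y" | "card Y < m" by linarith
  then show ?thesis
  proof cases
    case 1
    then have "card X < card Y" using rk_less_upper X by blast
    then have "X \<subset> Y" using X finite_mem[OF X(1)] card_mono[of X Y] by auto
    then show ?thesis using card_hits_Int_le_upper[OF finS _ sub(2,3)] 1 by (simp add: max_def)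
  next
    case 2
    then have "card Y < card X" using rk_less_lower X by blast
    then have "Y \<subset> X" using X finite_mem[OF assms(1)] card_mono[of Y X] by auto
    moreover have "X \<subset> S" using sub by auto
    ultimately show ?thesis
      using card_hits_Int_le_lower[OF finS, of Y X] 2 cardS by (simp add: max_def Int_commute)
  qed
qed

text \<open>Each blocking set removes at most the fraction \<open>1 / r\<close> of the chains
  through \<open>Y\<close>, and the number of these chains is the same for a set and its
  complement.\<close>

lemma cost_ge:
  fixes r :: nat
  assumes "Y \<in> F" and r: "r = max (card Y) (2 * m - card Y)"
  shows "real r * cost Y \<ge> (real r - real (card (D Y))) * (fact r * fact (2 * m - r))"
proof -
  have Y: "Y \<subseteq> S" "card Y < 2 * m" using assms subF card_bounds by auto
  have w: "real (card (hits S Y)) = fact r * fact (2 * m - r)"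
    using Y finS cardS unfolding r by (simp add: card_hits max_def)
  have "(\<Sum>X\<in>D Y. real r * real (card (hits S X \<inter> hits S Y)))
      \<le> (\<Sum>X\<in>D Y. real (card (hits S Y)))"
    using blocking_le[OF assms(1)] unfolding r
    by (intro sum_mono) (metis of_nat_le_iff of_nat_mult)
  then have "real r * (\<Sum>X\<in>D Y. real (card (hits S X \<inter> hits S Y)))
      \<le> real (card (D Y)) * real (card (hits S Y))"
    by (simp add: sum_distrib_left)
  then show ?thesis unfolding cost_def w[symmetric] by (simp add: algebra_simps)
qed

lemma cost_middle:
  assumes "Y \<in> F" "card Y = m"
  shows "cost Y = fact m * fact m"
proof -
  have "D Y = {}" using assms by (auto simp: D_def rk_def)
  then show ?thesis using assms finS subF cardS by (auto simp: cost_def card_hits)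
qed

text \<open>Here \<open>r = m + 1\<close>, and
  \<open>m * ((m + 1)! * (m - 1)!) = (m + 1) * m!^2\<close>; the factor \<open>m + 1\<close> then
  cancels.\<close>

lemma cost_near:
  assumes "Y \<in> F" "card Y = Suc m \<or> Suc (card Y) = m"
  shows "real m * cost Y \<ge> (real m + 1 - real (card (D Y))) * (fact m * fact m)"
proof -
  have "0 < m" using card_bounds[OF assms(1)] by simp
  then obtain k where k: "m = Suc k" by (cases m) auto
  have r: "Suc m = max (card Y) (2 * m - card Y)" using assms by auto
  have e: "2 * m - Suc m = k" using k by simp
  let ?d = "real (card (D Y))"
  have "real (Suc m) * cost Y \<ge> (real (Suc m) - ?d) * (fact (Suc m) * fact k)"
    using cost_ge[OF assms(1) r] unfolding e .
  then have "real m * (real (Suc m) * cost Y)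
      \<ge> real m * ((real (Suc m) - ?d) * (fact (Suc m) * fact k))"
    by (rule mult_left_mono) simp
  also have "real m * ((real (Suc m) - ?d) * (fact (Suc m) * fact k))
     = real (Suc m) * ((real (Suc m) - ?d) * (fact m * (real m * fact k)))"
    by (simp add: algebra_simps)
  also have "real m * fact k = (fact m :: real)" using k by simp
  finally have "real (Suc m) * ((real (Suc m) - ?d) * (fact m * fact m))
     \<le> real (Suc m) * (real m * cost Y)" by (simp add: mult_ac)
  then have "(real (Suc m) - ?d) * (fact m * fact m) \<le> real m * cost Y"
    by (rule mult_left_le_imp_le) simp
  then show ?thesis by (simp add: algebra_simps)
qed

text \<open>Even three blocking sets leave \<open>(1 - 3 / r) * r! * (2 * m - r)!\<close>. Both the
  fraction and the factorial product grow with \<open>r\<close>, and at \<open>r = m + 2\<close> the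
  bound is exactly the one claimed.\<close>

lemma cost_far:
  assumes "Y \<in> F" "card Y \<ge> m + 2 \<or> card Y + 2 \<le> m" "card (D Y) \<le> 3"
  shows "real m * cost Y \<ge> (real m + 1) * (fact m * fact m)"
proof -
  define r where "r = max (card Y) (2 * m - card Y)"
  have r: "m + 2 \<le> r" "r < 2 * m"
    using assms card_bounds[OF assms(1)] by (auto simp: r_def)
  define k where "k = m - 2"
  have k: "m = k + 2" using r by (simp add: k_def)
  define w :: real where "w = fact r * fact (2 * m - r)"
  have "fact (m + 2) * fact (2 * m - (m + 2)) \<le> (fact r * fact (2 * m - r) :: nat)"
    using r by (intro fact_mult_fact_mono) auto
  then have "real (fact (m + 2) * fact (2 * m - (m + 2))) \<le> real (fact r * fact (2 * m - r))"
    using of_nat_le_iff by blast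
  moreover have "2 * m - (m + 2) = k" using k by simp
  ultimately have w: "fact (m + 2) * fact k \<le> w"
    unfolding w_def of_nat_mult of_nat_fact by (simp only:)
  have "(real r - 3) * w \<le> (real r - real (card (D Y))) * w"
    using assms(3) by (intro mult_right_mono) (auto simp: w_def)
  also have "\<dots> \<le> real r * cost Y"
    using cost_ge[OF assms(1) r_def] by (simp add: w_def)
  finally have "(real r - 3) * w \<le> real r * cost Y" .
  then have c: "(real r - 3) / real r * w \<le> cost Y"
    using r by (simp add: field_simps)
  have "(real m - 1) / (real m + 2) \<le> (real r - 3) / real r"
    using r by (simp add: field_simps)
  then have "(real m - 1) / (real m + 2) * (fact (m + 2) * fact k) \<le> (real r - 3) / real r * w"
    using w k r by (intro mult_mono) auto
  then have "real m * ((real m - 1) / (real m + 2) * (fact (m + 2) * fact k)) \<le> real m * cost Y"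
    using c by (intro mult_left_mono) auto
  also have "real m * ((real m - 1) / (real m + 2) * (fact (m + 2) * fact k))
     = (real m + 1) * (fact m * (real m * ((real m - 1) * fact k)))"
    by (simp add: field_simps)
  also have "real m * ((real m - 1) * fact k) = fact m"
    unfolding k by (simp add: algebra_simps)
  finally show ?thesis .
qed

section \<open>Counting the charges along each chain\<close>

lemma chain_through_middle:
  assumes "xs \<in> permutations_of_set S" "xs \<in> hits S X" "xs \<in> hits S Y" "card X \<le> j" "j \<le> card Y"
    "Y \<subseteq> S"
  obtains M where "xs \<in> hits S M" "card M = j" "X \<subseteq> M" "M \<subseteq> Y"
proof
  \<comment> \<open>The witness is the member of the chain at level \<open>j\<close>.\<close>
  let ?M = "set (take j xs)"
  have d: "distinct xs" "length xs = 2 * m"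
    using assms(1) cardS by (auto simp: length_of_permutation dest: permutations_of_setD)
  have "card Y \<le> 2 * m" using assms card_mono[OF finS] cardS by metis
  then show c: "card ?M = j"
    using d assms by (simp add: distinct_card)
  show "xs \<in> hits S ?M" using assms(1) c by (simp add: hits_def)
  show "X \<subseteq> ?M" "?M \<subseteq> Y"
    using assms(2,3) set_take_subset_set_take[OF assms(4), of xs]
      set_take_subset_set_take[OF assms(5), of xs] by (simp_all add: hits_def)
qed

lemma hits_comparable:
  assumes "xs \<in> hits S X" "xs \<in> hits S Y" "card X \<le> card Y"
  shows "X \<subseteq> Y"
  using assms(1,2) set_take_subset_set_take[OF assms(3), of xs] by (simp add: hits_def)

text \<open>The member of least rank on the chain contributes at most 1. It blocks every other
  member there, so each of those contributes at most 0.\<close>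

lemma chain_count_le_1:
  assumes xs: "xs \<in> permutations_of_set S"
  defines "H \<equiv> {Y \<in> F. xs \<in> hits S Y}"
  shows "(\<Sum>Y\<in>H. 1 - real (card (D Y \<inter> H))) \<le> 1"
proof (cases "H = {}")
  case False
  have finH: "finite H" using finF by (simp add: H_def)
  obtain X where X: "X \<in> H" and least: "\<And>Y. Y \<in> H \<Longrightarrow> rk m X \<le> rk m Y"
    using False arg_min_if_finite[OF finH False, of "rk m"]
    by (metis not_le)
  have "X \<in> D Y" if Y: "Y \<in> H" "Y \<noteq> X" for Y
  proof -
    have cmp: "X \<subseteq> Y \<or> Y \<subseteq> X"
      using hits_comparable X Y nat_le_linear unfolding H_def by blast
    have "card X \<noteq> card Y"
      using cmp Y finite_mem X card_subset_eq[of X Y] card_subset_eq[of Y X] by (auto simp: H_def)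
    then have less: "rk m X < rk m Y" using least[OF Y(1)] rk_inj[of m X Y] by linarith
    \<comment> \<open>For a pair left out of \<open>D\<close>, the chain would contain a middle set
      of \<open>F\<close>, of rank 0, against the minimality of \<open>X\<close>.\<close>
    have "\<not> (rk m X = 1 \<and> rk m Y = 2 \<and> (\<forall>M. X \<subset> M \<and> M \<subset> Y \<longrightarrow> M \<in> F))"
    proof
      assume a: "rk m X = 1 \<and> rk m Y = 2 \<and> (\<forall>M. X \<subset> M \<and> M \<subset> Y \<longrightarrow> M \<in> F)"
      then have c: "Suc (card X) = m" "card Y = Suc m" using rk_1[of m X] rk_2[of m Y] by auto
      have "Y \<subseteq> S" using Y subF by (auto simp: H_def)
      then obtain M where M: "xs \<in> hits S M" "card M = m" "X \<subseteq> M" "M \<subseteq> Y"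
        using chain_through_middle[OF xs, of X Y m] X Y c unfolding H_def by auto
      then have "X \<subset> M" "M \<subset> Y" using c by auto
      then have "M \<in> H" using a M by (auto simp: H_def)
      then show False using least[of M] a M(2) rk_0[of m M] by simp
    qed
    then show ?thesis using X cmp less by (auto simp: D_def H_def)
  qed
  then have "1 \<le> card (D Y \<inter> H)" if "Y \<in> H - {X}" for Y
  proof -
    have "X \<in> D Y \<inter> H" using that X \<open>\<And>Y. Y \<in> H \<Longrightarrow> Y \<noteq> X \<Longrightarrow> X \<in> D Y\<close> by blast
    then show ?thesis using finH by (metis One_nat_def Suc_leI card_gt_0_iff empty_iff finite_Int)
  qed
  then have "(\<Sum>Y\<in>H - {X}. 1 - real (card (D Y \<inter> H))) \<le> 0"
    by (intro sum_nonpos) simp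
  then show ?thesis using sum.remove[OF finH X, of "\<lambda>Y. 1 - real (card (D Y \<inter> H))"] by simp
qed simp

text \<open>Double counting: write every cost as a sum over the chains, exchange the sums, and bound
  the contribution of each chain by 1.\<close>

lemma sum_cost_le: "sum cost F \<le> fact (2 * m)"
proof -
  let ?P = "permutations_of_set S"
  have finP: "finite ?P" by simp
  have 1: "real (card (hits S Y)) = (\<Sum>xs\<in>?P. of_bool (xs \<in> hits S Y))" for Y
    by (simp add: hits_def Int_def)
  have 2: "real (card (hits S X \<inter> hits S Y)) =
      (\<Sum>xs\<in>?P. of_bool (xs \<in> hits S X) * of_bool (xs \<in> hits S Y))" for X Y
  proof -
    have "hits S X \<inter> hits S Y = ?P \<inter> {xs. xs \<in> hits S X \<and> xs \<in> hits S Y}"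
      by (auto simp: hits_def)
    then show ?thesis by (simp flip: of_bool_conj)
  qed
  have "sum cost F = (\<Sum>Y\<in>F. \<Sum>xs\<in>?P. of_bool (xs \<in> hits S Y)
      * (1 - (\<Sum>X\<in>D Y. of_bool (xs \<in> hits S X))))"
  proof (rule sum.cong[OF refl])
    fix Y
    have "(\<Sum>X\<in>D Y. real (card (hits S X \<inter> hits S Y))) =
      (\<Sum>xs\<in>?P. \<Sum>X\<in>D Y. of_bool (xs \<in> hits S X) * of_bool (xs \<in> hits S Y))"
      unfolding 2 by (rule sum.swap)
    then show "cost Y = (\<Sum>xs\<in>?P. of_bool (xs \<in> hits S Y)
      * (1 - (\<Sum>X\<in>D Y. of_bool (xs \<in> hits S X))))"
      unfolding cost_def 1 by (simp add: sum_subtractf right_diff_distrib sum_distrib_left mult.commute)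
  qed
  also have "\<dots> = (\<Sum>xs\<in>?P. \<Sum>Y\<in>F. of_bool (xs \<in> hits S Y)
      * (1 - (\<Sum>X\<in>D Y. of_bool (xs \<in> hits S X))))"
    by (rule sum.swap)
  also have "\<dots> \<le> (\<Sum>xs\<in>?P. 1)"
  proof (rule sum_mono)
    fix xs assume xs: "xs \<in> ?P"
    define H where "H = {Y \<in> F. xs \<in> hits S Y}"
    have "(\<Sum>X\<in>D Y. of_bool (xs \<in> hits S X)) = real (card (D Y \<inter> H))" for Y
    proof -
      have "D Y \<inter> H = D Y \<inter> {X. xs \<in> hits S X}" using D_subset by (auto simp: H_def)
      then show ?thesis using finD by simp
    qed
    then have "(\<Sum>Y\<in>F. of_bool (xs \<in> hits S Y) * (1 - (\<Sum>X\<in>D Y. of_bool (xs \<in> hits S X))))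
        = (\<Sum>Y\<in>F. if xs \<in> hits S Y then 1 - real (card (D Y \<inter> H)) else 0)"
      by (intro sum.cong) auto
    also have "\<dots> = (\<Sum>Y\<in>H. 1 - real (card (D Y \<inter> H)))"
      unfolding H_def by (rule sum.inter_filter[OF finF, symmetric])
    also have "\<dots> \<le> 1" using chain_count_le_1[OF xs] unfolding H_def .
    finally show "(\<Sum>Y\<in>F. of_bool (xs \<in> hits S Y)
      * (1 - (\<Sum>X\<in>D Y. of_bool (xs \<in> hits S X)))) \<le> (1::real)" .
  qed
  also have "\<dots> = fact (2 * m)" using finS cardS by simp
  finally show ?thesis .
qed


section \<open>Losses within one component\<close>

lemma card_D_diamond:
  assumes "A \<in> F" "B \<in> F" "rk m A = 1" "rk m B = 2" "finite M" "card M = 2"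
    and M: "\<And>X. X \<in> M \<Longrightarrow> rk m X = 0"
    and D: "D A \<subseteq> M" "D B \<subseteq> insert A M"
  shows "card (D A) + card (D B) \<le> 4"
proof (cases "A \<in> D B")
  case False
  then have "D B \<subseteq> M" using D by auto
  then show ?thesis using D assms card_mono[of M "D A"] card_mono[of M "D B"] by simp
next
  \<comment> \<open>The crude bounds are 2 for \<open>A\<close> and 3 for \<open>B\<close>, so one
    blocking must be saved. As \<open>A\<close> does block \<open>B\<close>, the pair was not left
    out of \<open>D\<close>, and some \<open>N\<close> between them is missing from
    \<open>F\<close>.\<close>
  case True
  have c: "Suc (card A) = m" "card B = Suc m" using assms rk_1[of m A] rk_2[of m B] by auto
  have AB: "A \<subseteq> B"
    using True c card_mono[of A B] finite_mem[OF \<open>A \<in> F\<close>] by (auto simp: D_def)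
  obtain N where N: "A \<subset> N" "N \<subset> B" "N \<notin> F"
    using True assms by (auto simp: D_def)
  \<comment> \<open>Otherwise both sets of \<open>M\<close> lie between \<open>A\<close> and
    \<open>B\<close>. There is room for only two sets, so \<open>N\<close> would be one of them and
    hence in \<open>F\<close>.\<close>
  have "\<not> (M \<subseteq> D A \<and> M \<subseteq> D B)"
  proof
    assume a: "M \<subseteq> D A \<and> M \<subseteq> D B"
    have "insert N M \<subseteq> {X. A \<subset> X \<and> X \<subset> B}"
    proof -
      have "A \<subset> X \<and> X \<subset> B" if "X \<in> M" for X
      proof -
        have "card X = m" using M[OF that] rk_0[of m X] by simp
        moreover have "X \<in> F" "X \<subseteq> A \<or> A \<subseteq> X" "X \<subseteq> B \<or> B \<subseteq> X"
          using a that by (auto simp: D_def)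
        ultimately show ?thesis
          using c card_mono[of A X] card_mono[of X B] finite_mem assms(1,2) by fastforce
      qed
      then show ?thesis using N by auto
    qed
    moreover have "finite {X. A \<subset> X \<and> X \<subset> B}"
      using finite_mem[OF \<open>B \<in> F\<close>] by (rule_tac finite_subset[of _ "Pow B"]) auto
    ultimately have "card (insert N M) \<le> card {X. A \<subset> X \<and> X \<subset> B}"
      by (intro card_mono)
    also have "\<dots> \<le> 2"
      using card_between_le_2[OF finite_mem[OF \<open>B \<in> F\<close>] AB] c by simp
    finally have "N \<in> M" using assms by (simp add: card_insert_if split: if_splits)
    then show False using a N by (auto simp: D_def)
  qed
  then have "D A \<subset> M \<or> D B - {A} \<subset> M" using D by auto
  moreover have sub: "D A \<subseteq> M" "D B - {A} \<subseteq> M" using D by auto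
  ultimately have "card (D A) + card (D B - {A}) < card M + card M"
    using psubset_card_mono[OF \<open>finite M\<close>] card_mono[OF \<open>finite M\<close>]
    by (metis add_less_le_mono add_le_less_mono)
  then show ?thesis using True finD assms by (simp add: card_Diff_singleton)
qed

text \<open>The variables count the vertices of a component of rank 0, 1, 2 and at least 3. A set of
  rank 1 has at most \<open>k\<close> blocking sets, one of rank 2 at most \<open>k + l\<close>. In
  the excluded case the left side is 10 and the right side 8.\<close>

lemma near_arith:
  fixes k l u f :: nat
  assumes "k + l + u + f \<le> 4" "\<not> (k = 2 \<and> l = 1 \<and> u = 1)"
  shows "2 * (l * k + u * (k + l)) \<le> k + 3 * l + 3 * u + 3 * f"
proof -
  have "k \<in> {0,1,2,3,4}" "l \<in> {0,1,2,3,4}" "u \<in> {0,1,2,3,4}" using assms(1) by auto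
  then show ?thesis using assms by (elim insertE emptyE) simp_all
qed

text \<open>In units of \<open>m!^2 / m\<close>, each set starts with \<open>m\<close> in the middle
  and \<open>m + 1\<close> elsewhere, and each blocking of a set of rank 1 or 2 loses 1. On average
  a vertex must keep \<open>m - 1 / 2\<close>.\<close>

lemma sum_cost_component:
  assumes "C \<subseteq> F" "card C \<le> 4" and closed: "\<And>Y. Y \<in> C \<Longrightarrow> D Y \<subseteq> C"
  shows "(real m - 1 / 2) * real (card C) * (fact m * fact m) \<le> real m * sum cost C"
proof -
  define K where "K = {Y \<in> C. rk m Y = 0}"
  define L where "L = {Y \<in> C. rk m Y = 1}"
  define U where "U = {Y \<in> C. rk m Y = 2}"
  define R where "R = {Y \<in> C. 3 \<le> rk m Y}"
  have finC: "finite C" using assms(1) finF finite_subset by blast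
  then have fin: "finite K" "finite L" "finite U" "finite R"
    by (simp_all add: K_def L_def U_def R_def)
  have C: "C = K \<union> (L \<union> (U \<union> R))"
  proof -
    have "rk m Y = 0 \<or> rk m Y = 1 \<or> rk m Y = 2 \<or> 3 \<le> rk m Y" for Y :: "'a set" by linarith
    then show ?thesis unfolding K_def L_def U_def R_def by auto
  qed
  have disj: "K \<inter> (L \<union> (U \<union> R)) = {}" "L \<inter> (U \<union> R) = {}" "U \<inter> R = {}"
    by (auto simp: K_def L_def U_def R_def)
  have cardC: "card C = card K + (card L + (card U + card R))"
    unfolding C using fin disj by (simp add: card_Un_disjoint)
  have sumC: "sum h C = sum h K + (sum h L + (sum h U + sum h R))" for h :: "'a set \<Rightarrow> real"
    unfolding C using fin disj by (simp add: sum.union_disjoint)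
  have DL: "D Y \<subseteq> K" if "Y \<in> L" for Y
    using that closed[of Y] by (auto simp: L_def K_def D_def)
  have DU: "D Y \<subseteq> K \<union> L" if "Y \<in> U" for Y
  proof
    fix X assume X: "X \<in> D Y"
    then have "rk m X < 2" "X \<in> C" using that closed[of Y] by (auto simp: U_def D_def)
    then show "X \<in> K \<union> L" by (auto simp: K_def L_def)
  qed
  \<comment> \<open>Only the other vertices of the component can block \<open>Y\<close>.\<close>
  have D3: "card (D Y) \<le> 3" if "Y \<in> C" for Y
  proof -
    have "D Y \<subseteq> C - {Y}" using closed[OF that] not_mem_D by auto
    then have "card (D Y) \<le> card C - 1"
      using card_mono[of "C - {Y}"] finC that by (simp add: card_Diff_singleton)
    then show ?thesis using assms(2) by simp
  qed
  have "card (D Y) \<le> card K" if "Y \<in> L" for Y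
    using card_mono[OF _ DL[OF that]] fin by simp
  then have sL: "(\<Sum>Y\<in>L. card (D Y)) \<le> card L * card K"
    using sum_bounded_above[of L "\<lambda>Y. card (D Y)" "card K"] by simp
  have "card (D Y) \<le> card K + card L" if "Y \<in> U" for Y
    using card_mono[OF _ DU[OF that]] fin card_Un_le[of K L] by simp
  then have sU: "(\<Sum>Y\<in>U. card (D Y)) \<le> card U * (card K + card L)"
    using sum_bounded_above[of U "\<lambda>Y. card (D Y)" "card K + card L"] by simp
  define d where "d = (\<Sum>Y\<in>L. card (D Y)) + (\<Sum>Y\<in>U. card (D Y))"
  \<comment> \<open>This is \<open>d - (card L + card U + card R) \<le> card C / 2\<close>: the
    losses minus the gains off the middle are at most half per vertex. The diamond, with
    \<open>d = 4\<close>, attains equality.\<close>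
  have d: "2 * d \<le> card K + 3 * card L + 3 * card U + 3 * card R"
  proof (cases "card K = 2 \<and> card L = 1 \<and> card U = 1")
    case True
    then obtain A B where AB: "L = {A}" "U = {B}" by (meson card_1_singletonE)
    then have "A \<in> L" "B \<in> U" by auto
    then have "card (D A) + card (D B) \<le> 4"
      using True DL[of A] DU[of B] AB fin assms(1)
      by (intro card_D_diamond[of A B K]) (auto simp: L_def U_def K_def)
    then show ?thesis using True AB by (simp add: d_def)
  next
    case False
    then have "2 * (card L * card K + card U * (card K + card L))
        \<le> card K + 3 * card L + 3 * card U + 3 * card R"
      using assms(2) cardC by (intro near_arith) auto
    moreover have "2 * d \<le> 2 * (card L * card K + card U * (card K + card L))"
      unfolding d_def using add_mono[OF sL sU] by (rule mult_le_mono2)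
    ultimately show ?thesis by (rule order_trans[rotated])
  qed
  let ?w = "fact m * fact m :: real"
  have K: "real m * cost Y = real m * ?w" if "Y \<in> K" for Y
    using that assms(1) cost_middle[of Y] rk_0[of m Y] by (auto simp: K_def)
  have N: "(real m + 1 - real (card (D Y))) * ?w \<le> real m * cost Y" if "Y \<in> L \<or> Y \<in> U" for Y
    using that assms(1) cost_near[of Y] rk_1[of m Y] rk_2[of m Y] by (auto simp: L_def U_def)
  have R: "(real m + 1) * ?w \<le> real m * cost Y" if "Y \<in> R" for Y
    using that assms(1) cost_far[of Y] rk_ge_3[of m Y] D3[of Y] by (auto simp: R_def)
  have 0: "real (card K) * (real m * ?w) = (\<Sum>Y\<in>K. real m * cost Y)"
    using sum.cong[OF refl K, of K "\<lambda>Y. Y"] by simp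
  have 1: "(real (card L) * (real m + 1) - (\<Sum>Y\<in>L. real (card (D Y)))) * ?w
      \<le> (\<Sum>Y\<in>L. real m * cost Y)"
    using sum_mono[of L "\<lambda>Y. (real m + 1 - real (card (D Y))) * ?w" "\<lambda>Y. real m * cost Y"] N
    by (simp add: sum_subtractf flip: sum_distrib_right)
  have 2: "(real (card U) * (real m + 1) - (\<Sum>Y\<in>U. real (card (D Y)))) * ?w
      \<le> (\<Sum>Y\<in>U. real m * cost Y)"
    using sum_mono[of U "\<lambda>Y. (real m + 1 - real (card (D Y))) * ?w" "\<lambda>Y. real m * cost Y"] N
    by (simp add: sum_subtractf flip: sum_distrib_right)
  have 3: "real (card R) * ((real m + 1) * ?w) \<le> (\<Sum>Y\<in>R. real m * cost Y)"
    using sum_mono[of R "\<lambda>Y. (real m + 1) * ?w" "\<lambda>Y. real m * cost Y"] R by simp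
  have rd: "real d = (\<Sum>Y\<in>L. real (card (D Y))) + (\<Sum>Y\<in>U. real (card (D Y)))"
    by (simp add: d_def)
  have "real (2 * d) \<le> real (card K + 3 * card L + 3 * card U + 3 * card R)"
    using d of_nat_le_iff by blast
  then have "(real m - 1 / 2) * real (card C) \<le> real (card K) * real m
      + real (card L) * (real m + 1) + real (card U) * (real m + 1)
      + real (card R) * (real m + 1) - real d"
    unfolding cardC by (simp add: algebra_simps)
  then have "(real m - 1 / 2) * real (card C) * ?w \<le> (real (card K) * real m
      + real (card L) * (real m + 1) + real (card U) * (real m + 1)
      + real (card R) * (real m + 1) - real d) * ?w"
    by (rule mult_right_mono) simp
  also have "\<dots> = real (card K) * (real m * ?w)
      + ((real (card L) * (real m + 1) - (\<Sum>Y\<in>L. real (card (D Y)))) * ?w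
      + ((real (card U) * (real m + 1) - (\<Sum>Y\<in>U. real (card (D Y)))) * ?w
      + real (card R) * ((real m + 1) * ?w)))"
    unfolding rd by (simp add: algebra_simps)
  also have "\<dots> \<le> (\<Sum>Y\<in>C. real m * cost Y)"
    unfolding sumC 0 using 1 2 3 by linarith
  finally show ?thesis by (simp add: sum_distrib_left)
qed

end

section \<open>Components\<close>

lemma comparability_component:
  assumes "A \<in> F" "B \<in> F" "A \<subseteq> B \<or> B \<subseteq> A"
  shows "(A, B) \<in> (comparability_edges F)\<^sup>*"
  using assms by (cases "A = B") (auto simp: comparability_edges_def)

lemma sym_comparability: "sym ((comparability_edges F)\<^sup>*)"
  by (intro sym_rtrancl) (auto simp: sym_def comparability_edges_def)

lemma components_subset:
  assumes "C \<in> components F (comparability_edges F)"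
  shows "C \<subseteq> F"
proof -
  obtain A where "A \<in> F" "C = (comparability_edges F)\<^sup>* `` {A}"
    using assms by (auto simp: components_def quotient_def)
  moreover have "B \<in> F" if "(A, B) \<in> (comparability_edges F)\<^sup>*" for B
    using that \<open>A \<in> F\<close> by cases (auto simp: comparability_edges_def)
  ultimately show ?thesis by auto
qed

text \<open>Consequently all sets that block a member of a component lie in that component, so the
  losses can be estimated component by component.\<close>

lemma components_closed:
  assumes "C \<in> components F (comparability_edges F)" "A \<in> C" "B \<in> F" "A \<subseteq> B \<or> B \<subseteq> A"
  shows "B \<in> C"
proof -
  have "A \<in> F" using components_subset assms by blast
  then have "(A, B) \<in> (comparability_edges F)\<^sup>*"
    using assms comparability_component by blast
  moreover obtain Z where "C = (comparability_edges F)\<^sup>* `` {Z}"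
    using assms(1) by (auto simp: components_def quotient_def)
  ultimately show ?thesis using assms(2) rtrancl_trans[of Z A _ B] by simp
qed

lemma Union_components: "\<Union> (components F (comparability_edges F)) = F"
proof
  show "\<Union> (components F (comparability_edges F)) \<subseteq> F"
    using components_subset by (rule Union_least)
  show "F \<subseteq> \<Union> (components F (comparability_edges F))"
    by (auto simp: components_def quotient_def)
qed

lemma components_disjoint:
  assumes "C \<in> components F (comparability_edges F)" "C' \<in> components F (comparability_edges F)"
    "C \<noteq> C'"
  shows "C \<inter> C' = {}"
proof (rule ccontr)
  let ?R = "(comparability_edges F)\<^sup>*"
  assume "C \<inter> C' \<noteq> {}"
  then obtain X A B where C: "C = ?R `` {A}" "C' = ?R `` {B}" and "(A, X) \<in> ?R" "(B, X) \<in> ?R"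
    using assms by (auto simp: components_def quotient_def)
  then have "(A, B) \<in> ?R" "(B, A) \<in> ?R"
    using symD[OF sym_comparability] rtrancl_trans by metis+
  then have "C = C'" unfolding C by (meson Image_singleton_iff rtrancl_trans subsetI subset_antisym)
  then show False using assms by simp
qed

text \<open>Applied to the empty set or the full set, this disposes of the families that contain one
  of them.\<close>

lemma whole_family_component:
  assumes "A \<in> F" "\<And>B. B \<in> F \<Longrightarrow> A \<subseteq> B \<or> B \<subseteq> A"
  shows "F \<in> components F (comparability_edges F)"
proof -
  let ?C = "(comparability_edges F)\<^sup>* `` {A}"
  have C: "?C \<in> components F (comparability_edges F)"
    using assms(1) by (simp add: components_def quotientI)
  moreover have "?C = F"
  proof
    show "?C \<subseteq> F" by (rule components_subset[OF C])
    show "F \<subseteq> ?C"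
    proof
      fix B assume "B \<in> F"
      then show "B \<in> ?C" using comparability_component[of A F B] assms by simp
    qed
  qed
  ultimately show ?thesis by (rule back_subst)
qed

section \<open>Summation over the components and the final bound\<close>

lemma (in middle_family) card_le:
  assumes "\<And>C. C \<in> components F (comparability_edges F) \<Longrightarrow> card C \<le> 4" "0 < m"
  shows "card F \<le> 4 * ((2 * m - 2) choose (m - 1))"
proof -
  let ?Q = "components F (comparability_edges F)"
  let ?w = "fact m * fact m :: real"
  have fin: "finite ?Q" "\<And>C. C \<in> ?Q \<Longrightarrow> finite C"
    using finF components_subset finite_subset
    by (auto simp: finite_UnionD Union_components) blast
  have Q: "sum h F = (\<Sum>C\<in>?Q. sum h C)" for h :: "'a set \<Rightarrow> real"
    using sum.Union_disjoint[of ?Q h] fin components_disjoint[of _ F]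
    unfolding Union_components comp_apply by blast
  have "(real m - 1 / 2) * ?w * real (card C) \<le> real m * sum cost C" if "C \<in> ?Q" for C
  proof -
    have "D Y \<subseteq> C" if "Y \<in> C" for Y
      using components_closed[OF \<open>C \<in> ?Q\<close> that] by (auto simp: D_def)
    then show ?thesis
      using sum_cost_component[of C] components_subset[OF that] assms(1)[OF that]
      by (simp add: mult_ac)
  qed
  then have "(\<Sum>C\<in>?Q. (real m - 1 / 2) * ?w * real (card C)) \<le> (\<Sum>C\<in>?Q. real m * sum cost C)"
    by (rule sum_mono)
  also have "\<dots> = real m * sum cost F" using Q[of cost] by (simp add: sum_distrib_left)
  also have "\<dots> \<le> real m * fact (2 * m)" using sum_cost_le by (simp add: mult_left_mono)
  finally have "(real m - 1 / 2) * ?w * real (card F) \<le> real m * fact (2 * m)"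
    using Q[of "\<lambda>_. 1"] by (simp flip: sum_distrib_left)
  then have le: "(2 * real m - 1) * real (card F) * ?w \<le> 2 * real m * fact (2 * m)"
    by (simp add: algebra_simps)
  \<comment> \<open>It remains to evaluate \<open>(2 * m)! / m!^2\<close> through the central
    binomial coefficient one step down, \<open>b = (2 * j choose j)\<close>: the ratio is
    \<open>2 * (2 * m - 1) * b / m\<close>.\<close>
  obtain j where m: "m = Suc j" using \<open>0 < m\<close> by (cases m) auto
  define b where "b = (2 * j choose j)"
  have "fact j * fact (2 * j - j) * (2 * j choose j) = (fact (2 * j) :: nat)"
    by (rule binomial_fact_lemma) simp
  then have "real (fact j * fact j * b) = real (fact (2 * j))"
    by (simp add: b_def mult_2)
  then have b: "fact (2 * j) = fact j * fact j * real b" by simp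
  have w: "?w = (real m)\<^sup>2 * (fact j * fact j)" using m by (simp add: power2_eq_square)
  have "fact (2 * m) = 2 * real m * ((2 * real m - 1) * fact (2 * j))"
    using m by (simp add: algebra_simps)
  with le have "(2 * real m - 1) * (real m)\<^sup>2 * (fact j * fact j) * real (card F)
      \<le> (2 * real m - 1) * (real m)\<^sup>2 * (fact j * fact j) * (4 * real b)"
    unfolding w b by (simp add: power2_eq_square mult_ac)
  moreover have "0 < (2 * real m - 1) * (real m)\<^sup>2 * (fact j * fact j)"
    using m by simp
  ultimately have "real (card F) \<le> 4 * real b" by (rule mult_left_le_imp_le)
  then have "card F \<le> 4 * b" by (metis of_nat_le_iff of_nat_mult of_nat_numeral)
  then show ?thesis using m by (simp add: b_def)
qed

theorem theorem3p4:
  fixes n :: nat and F :: "nat set set"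
  assumes "even n"
    and "F \<subseteq> Pow {1..n}"
    and "\<forall>C \<in> components F (comparability_edges F). card C \<le> 4"
  shows "card F \<le> 4 * ((n - 2) choose (n div 2 - 1))"
proof (cases "n = 0 \<or> {} \<in> F \<or> {1..n} \<in> F")
  \<comment> \<open>For \<open>n = 0\<close> a nonempty family also contains the empty set, so in
    every subcase a nonempty \<open>F\<close> is a single component.\<close>
  case True
  have "card F \<le> 4"
  proof (cases "F = {}")
    case False
    then obtain A where "A \<in> F" "\<And>B. B \<in> F \<Longrightarrow> A \<subseteq> B \<or> B \<subseteq> A"
      using True assms(2) by fastforce
    then show ?thesis using whole_family_component assms(3) by blast
  qed simp
  \<comment> \<open>Truncated subtraction turns this into \<open>0 choose 0\<close> when
    \<open>n = 0\<close>.\<close>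
  moreover have "1 \<le> (n - 2) choose (n div 2 - 1)"
    by (simp add: Suc_leI)
  ultimately show ?thesis by linarith
next
  case False
  obtain m where m: "n = 2 * m" using assms(1) by blast
  interpret middle_family "{1..n}" m F
    using False assms(2) m by unfold_locales auto
  show ?thesis using card_le assms(3) False m by simp
qed

end
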